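(* For any integer $d \geq 7$, there are compact, star-shaped sets $A_1, A_2, A_3 \subset \mathbb{R}^d$ satisfying $$\operatorname{vol}\left(A_1+ A_2+ A_3\right)^{1/d} < \frac{1}{2} \left( \operatorname{vol}\left(A_1+A_2\right)^{1/d} + \operatorname{vol}\left(A_1+A_3\right)^{1/d} + \operatorname{vol}\left(A_2+A_3\right)^{1/d} \right).$$
   Context: $A+B = \{a+b : a\in A,\ b\in B\}$ denotes the Minkowski sum and $\operatorname{vol}$ denotes Lebesgue measure on $\mathbb{R}^d$. A nonempty set $S \subset \mathbb{R}^d$ is star-shaped with respect to a point $p$ if for every $q \in S$ the closed segment $[p,q]$ is contained in $S$; $S$ is star-shaped if it is star-shaped with respect to some point $p$. *)

theory Defs
  imports "HOL-Analysis.Analysis"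
begin

end

theory Submission
  imports Defs
begin

text \<open>
  Split the coordinates into a block \<open>P\<close> of size 3, a block \<open>Q\<close> of size 4 and the rest, and write
  \<open>B(x, y, z)\<close> for the box with side lengths \<open>x\<close>, \<open>y\<close>, \<open>z\<close> on these blocks. Take
  \<open>A\<^sub>1 = B(1, 0, 0.44)\<close>, \<open>A\<^sub>2 = B(0, 1, 0.56)\<close> and \<open>A\<^sub>3 = B(3, 0, 1.04) \<union> B(0, 2, 1.04)\<close>.
  The pairwise sums contain \<open>B(1, 1, 1)\<close>, \<open>B(1, 2, 1.48)\<close> and \<open>B(3, 1, 1.6)\<close>, whose volumes are at
  least \<open>1\<close>, \<open>1.48\<^sup>d\<close> and \<open>1.6\<^sup>d\<close> because \<open>1.48\<^sup>7 \<le> 2\<^sup>4\<close> and \<open>1.6\<^sup>7 \<le> 3\<^sup>3\<close>. The triple sum is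
  \<open>B(4, 1, 2.04) \<union> B(1, 3, 2.04)\<close>, whose volume \<open>(4\<^sup>3 + 3\<^sup>4 - 1) * 2.04\<^bsup>d - 7\<^esup>\<close> is less than
  \<open>2.04\<^sup>d\<close>, and \<open>2.04 = (1 + 1.48 + 1.6) / 2\<close>.
\<close>

lemma cbox_0_plus_cbox_0:
  fixes u v :: "real ^ 'n::finite"
  assumes "0 \<le> u" "0 \<le> v"
  shows "cbox 0 u + cbox 0 v = cbox 0 (u + v)"
proof (intro equalityI subsetI)
  fix x assume "x \<in> cbox 0 u + cbox 0 v"
  then obtain y z where "y \<in> cbox 0 u" "z \<in> cbox 0 v" "x = y + z"
    by (rule set_plus_elim)
  then show "x \<in> cbox 0 (u + v)"
    by (auto simp: mem_box_cart intro: add_mono)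
next
  fix x assume x: "x \<in> cbox 0 (u + v)"
  \<comment> \<open>Truncating \<open>x\<close> at \<open>u\<close> in each coordinate leaves the
    remainder 0 or \<open>x $ i - u $ i\<close>, which is at most \<open>v $ i\<close>.\<close>
  define y where "y = (\<chi> i. min (x $ i) (u $ i))"
  have "y \<in> cbox 0 u" "x - y \<in> cbox 0 v"
    using x assms by (auto simp: y_def mem_box_cart less_eq_vec_def min_def algebra_simps)
  then have "y + (x - y) \<in> cbox 0 u + cbox 0 v"
    by (rule set_plus_intro)
  then show "x \<in> cbox 0 u + cbox 0 v" by simp
qed

lemma set_plus_Un_distrib: "A + (B \<union> C) = (A + B) \<union> (A + C)"
  for A B C :: "'a::plus set"
  by (auto simp: set_plus_def)

text \<open>Both boxes are convex and contain the origin, so 0 is a common star center.\<close>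

lemma starlike_Un_cbox_0:
  fixes u v :: "real ^ 'n::finite"
  assumes "0 \<le> u" "0 \<le> v"
  shows "starlike (cbox 0 u \<union> cbox 0 v)"
  unfolding starlike_def
proof (intro bexI ballI)
  have zero: "0 \<in> cbox 0 u" "0 \<in> cbox 0 v"
    using assms by (auto simp: mem_box_cart less_eq_vec_def)
  then show "0 \<in> cbox 0 u \<union> cbox 0 v" by simp
  fix x assume "x \<in> cbox 0 u \<union> cbox 0 v"
  then show "closed_segment 0 x \<subseteq> cbox 0 u \<union> cbox 0 v"
    using zero closed_segment_subset[OF _ _ convex_box(1)] by blast
qed

definition block_vec :: "'n set \<Rightarrow> 'n set \<Rightarrow> real \<Rightarrow> real \<Rightarrow> real \<Rightarrow> real ^ 'n::finite" where
  "block_vec P Q x y z = (\<chi> i. if i \<in> P then x else if i \<in> Q then y else z)"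

lemma block_vec_nonneg: "0 \<le> x \<Longrightarrow> 0 \<le> y \<Longrightarrow> 0 \<le> z \<Longrightarrow> 0 \<le> block_vec P Q x y z"
  by (simp add: block_vec_def less_eq_vec_def)

lemma block_vec_add:
  "block_vec P Q x y z + block_vec P Q x' y' z' = block_vec P Q (x + x') (y + y') (z + z')"
  by (simp add: block_vec_def vec_eq_iff)

lemma cbox_block_vec_plus:
  assumes "0 \<le> x" "0 \<le> y" "0 \<le> z" "0 \<le> x'" "0 \<le> y'" "0 \<le> z'"
  shows "cbox 0 (block_vec P Q x y z) + cbox 0 (block_vec P Q x' y' z')
    = cbox 0 (block_vec P Q (x + x') (y + y') (z + z'))"
  using assms by (simp add: cbox_0_plus_cbox_0 block_vec_nonneg block_vec_add)

text \<open>All boxes share the lower corner 0, so only upper bounds compete. This supplies the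
  overlap term for inclusion-exclusion.\<close>

lemma cbox_block_vec_Int:
  "cbox 0 (block_vec P Q x y z) \<inter> cbox 0 (block_vec P Q x' y' z')
    = cbox 0 (block_vec P Q (min x x') (min y y') (min z z'))"
  by (auto simp: set_eq_iff mem_box_cart block_vec_def split: if_splits)

lemma measure_cbox_block_vec:
  fixes P Q :: "'n::finite set"
  assumes "P \<inter> Q = {}" "0 \<le> x" "0 \<le> y" "0 \<le> z"
  shows "measure lebesgue (cbox 0 (block_vec P Q x y z))
    = x ^ card P * y ^ card Q * z ^ (CARD('n) - (card P + card Q))"
proof -
  have "cbox 0 (block_vec P Q x y z) \<noteq> {}"
    using block_vec_nonneg[OF assms(2-)] by (auto simp: interval_ne_empty_cart less_eq_vec_def)
  then have "measure lebesgue (cbox 0 (block_vec P Q x y z))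
      = (\<Prod>i\<in>UNIV. if i \<in> P then x else if i \<in> Q then y else z)"
    by (simp add: content_cbox_cart block_vec_def)
  \<comment> \<open>The product splits first along \<open>P\<close>, then its part over
    \<open>- P\<close> splits along \<open>Q\<close>.\<close>
  also have "\<dots> = x ^ card P * (y ^ card (- P \<inter> Q) * z ^ card (- P \<inter> - Q))"
    by (simp add: prod.If_cases prod.If_cases[where A = "- P"])
  also have "- P \<inter> Q = Q" using assms by auto
  also have "- P \<inter> - Q = - (P \<union> Q)" by auto
  also have "card (- (P \<union> Q)) = CARD('n) - (card P + card Q)"
    using assms by (simp add: Compl_eq_Diff_UNIV card_Diff_subset card_Un_disjoint)
  finally show ?thesis by simp
qed

lemma power_powr_inverse:
  assumes "0 < c" "0 < d"
  shows "(c ^ d) powr (1 / real d) = (c::real)"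
  using assms by (simp add: powr_realpow[symmetric] powr_powr)

lemma powr_inverse_ge:
  assumes "0 < c" "0 < d" "c ^ d \<le> (v::real)"
  shows "c \<le> v powr (1 / real d)"
  using powr_mono2[of "1 / real d" "c ^ d" v] assms by (simp add: power_powr_inverse)

lemma powr_inverse_less:
  assumes "0 < c" "0 < d" "0 \<le> v" "v < (c::real) ^ d"
  shows "v powr (1 / real d) < c"
  using powr_less_mono2[of "1 / real d" v "c ^ d"] assms by (simp add: power_powr_inverse)

theorem proposition2:
  assumes "CARD('n::finite) \<ge> 7"
  shows "\<exists>A\<^sub>1 A\<^sub>2 A\<^sub>3 :: (real ^ 'n) set.
    compact A\<^sub>1 \<and> starlike A\<^sub>1 \<and>
    compact A\<^sub>2 \<and> starlike A\<^sub>2 \<and>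
    compact A\<^sub>3 \<and> starlike A\<^sub>3 \<and>
    measure lebesgue (A\<^sub>1 + A\<^sub>2 + A\<^sub>3) powr (1 / real CARD('n)) <
      1 / 2 * (measure lebesgue (A\<^sub>1 + A\<^sub>2) powr (1 / real CARD('n))
             + measure lebesgue (A\<^sub>1 + A\<^sub>3) powr (1 / real CARD('n))
             + measure lebesgue (A\<^sub>2 + A\<^sub>3) powr (1 / real CARD('n)))"
proof -
  obtain R :: "'n set" where R: "card R = 7"
    using obtain_subset_with_card_n[OF assms] by blast
  obtain P where P: "P \<subseteq> R" "card P = 3"
    using obtain_subset_with_card_n[of 3 R] R by auto
  define Q where "Q = R - P"
  have PQ: "P \<inter> Q = {}" and cardQ: "card Q = 4"
    using P R by (auto simp: Q_def card_Diff_subset finite_subset)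
  define B where "B x y z = cbox 0 (block_vec P Q x y z)" for x y z
  define d where "d = CARD('n)"
  define m where "m = d - 7"
  \<comment> \<open>The bound on the dimension makes the truncated subtraction exact; for
    \<open>d = 7\<close> the third block is empty.\<close>
  have d: "d = 7 + m" using assms by (simp add: d_def m_def)
  have plus: "B x y z + B x' y' z' = B (x + x') (y + y') (z + z')"
    if "0 \<le> x" "0 \<le> y" "0 \<le> z" "0 \<le> x'" "0 \<le> y'" "0 \<le> z'" for x y z x' y' z'
    using that by (simp add: B_def cbox_block_vec_plus)
  have vol: "measure lebesgue (B x y z) = x ^ 3 * y ^ 4 * z ^ m" if "0 \<le> x" "0 \<le> y" "0 \<le> z" for x y z
    using measure_cbox_block_vec[OF PQ that] P(2) cardQ by (simp add: B_def m_def d_def)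
  have meas [simp]: "B x y z \<in> lmeasurable" for x y z
    by (simp add: B_def)
  have compact: "compact (B x y z)" for x y z
    by (simp add: B_def)
  \<comment> \<open>The third sides a, b, c solve a + b = 1, a + c = 1.48, b + c = 1.6.\<close>
  define A1 where "A1 = B 1 0 (44/100)"
  define A2 where "A2 = B 0 1 (56/100)"
  define A3 where "A3 = B 3 0 (104/100) \<union> B 0 2 (104/100)"
  have starlike: "starlike A1" "starlike A2" "starlike A3"
    \<comment> \<open>A single box is treated as its union with itself.\<close>
    using starlike_Un_cbox_0[of "block_vec P Q 1 0 (44/100)" "block_vec P Q 1 0 (44/100)"]
      starlike_Un_cbox_0[of "block_vec P Q 0 1 (56/100)" "block_vec P Q 0 1 (56/100)"]
    by (auto simp: A1_def A2_def A3_def B_def intro!: starlike_Un_cbox_0 block_vec_nonneg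
        simp: block_vec_nonneg)
  have sum12: "A1 + A2 = B 1 1 1"
    by (simp add: A1_def A2_def plus)
  have sum13: "A1 + A3 = B 4 0 (148/100) \<union> B 1 2 (148/100)"
    by (simp add: A1_def A3_def plus set_plus_Un_distrib)
  have sum23: "A2 + A3 = B 3 1 (16/10) \<union> B 0 3 (16/10)"
    by (simp add: A2_def A3_def plus set_plus_Un_distrib)
  have sum123: "A1 + A2 + A3 = B 4 1 (204/100) \<union> B 1 3 (204/100)"
    unfolding sum12 by (simp add: A3_def plus set_plus_Un_distrib)
  have "(1::real) ^ d \<le> measure lebesgue (A1 + A2)"
    by (simp add: sum12 vol)
  then have vol12: "1 \<le> measure lebesgue (A1 + A2) powr (1 / d)"
    by (intro powr_inverse_ge) (auto simp: d)
  have "(148/100) ^ d \<le> measure lebesgue (B 1 2 (148/100))"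
    using mult_right_mono[of "(148/100) ^ 7" 16 "(148/100 :: real) ^ m"]
    by (simp add: vol d power_add power_divide)
  \<comment> \<open>The other box of the union has side 0 on \<open>Q\<close>, hence volume 0, so
    keeping one box loses nothing.\<close>
  also have "\<dots> \<le> measure lebesgue (A1 + A3)"
    unfolding sum13 by (intro measure_mono_fmeasurable) (auto intro: fmeasurableD)
  finally have vol13: "148/100 \<le> measure lebesgue (A1 + A3) powr (1 / d)"
    by (intro powr_inverse_ge) (auto simp: d)
  have "(16/10) ^ d \<le> measure lebesgue (B 3 1 (16/10))"
    using mult_right_mono[of "(16/10) ^ 7" 27 "(16/10 :: real) ^ m"]
    by (simp add: vol d power_add power_divide)
  also have "\<dots> \<le> measure lebesgue (A2 + A3)"
    unfolding sum23 by (intro measure_mono_fmeasurable) (auto intro: fmeasurableD)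
  finally have vol23: "16/10 \<le> measure lebesgue (A2 + A3) powr (1 / d)"
    by (intro powr_inverse_ge) (auto simp: d)
  have "B 4 1 (204/100) \<inter> B 1 3 (204/100) = B 1 1 (204/100)"
    by (simp add: B_def cbox_block_vec_Int)
  \<comment> \<open>Inclusion-exclusion: 64 + 81 - 1 = 144, to be compared with 2.04 to the power 7,
    about 147.\<close>
  then have "measure lebesgue (A1 + A2 + A3) = 144 * (204/100) ^ m"
    unfolding sum123 by (subst measure_Un3) (auto simp: vol)
  also have "\<dots> < (204/100) ^ d"
    using mult_strict_right_mono[of 144 "(204/100) ^ 7" "(204/100 :: real) ^ m"]
    by (simp add: d power_add power_divide)
  finally have "measure lebesgue (A1 + A2 + A3) powr (1 / d) < 204/100"
    by (intro powr_inverse_less) (auto simp: d)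
  also have "\<dots> \<le> 1 / 2 * (measure lebesgue (A1 + A2) powr (1 / d)
      + measure lebesgue (A1 + A3) powr (1 / d) + measure lebesgue (A2 + A3) powr (1 / d))"
    using vol12 vol13 vol23 by simp
  finally show ?thesis
    using starlike compact unfolding d_def A1_def A2_def A3_def
    by (intro exI conjI) (auto intro: compact_Un)
qed

end
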